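(* Let $X^0=[a,b]\subset\mathbb{R}^n$ be a box, let $f:\mathbb{R}^n\to\mathbb{R}$ be a non-convex twice continuously differentiable function, and let $\varepsilon>0$. At the end of the piecewise convexification algorithm (described in the context) with input $X^0,f,\varepsilon$, its output $\mathcal{X}_{ap}^{new}$ is a subset of the approximate global optimal solution set $$\mathcal{X}_{op}^{\varepsilon}=\{x\in X^0: f(x)\le f(y)+\varepsilon\ \forall y\in X^0\}.$$
   Context: A box is a set $[a,b]=\prod_{i=1}^n[a_i,b_i]$ with $a_i<b_i$. For a box $Y=[a^Y,b^Y]$ and $d\in\mathbb{R}^n$ with positive entries put $$S(Y,i,d)=\sum_{j\neq i}\max\left\{\left|\min_{x\in Y}\nabla^2 f(x)_{ij}\right|,\left|\max_{x\in Y}\nabla^2 f(x)_{ij}\right|\right\}\frac{d_j}{d_i},$$ and $\tilde\lambda_Y=\min_{i}\left(\min_{x\in Y}\nabla^2 f(x)_{ii}-S(Y,i,\mathbf{1})\right)$, $\mathbf{1}=(1,\dots,1)$. The formula $$\alpha_i=\max\left\{0,-\tfrac12\left(\min_{x\in Y}\nabla^2 f(x)_{ii}-S(Y,i,b^Y-a^Y)\right)\right\},\quad i=1,\dots,n,\qquad( * )$$ defines the parameter vector of $Y$, except that for sub-boxes $Y$ with $\tilde\lambda_Y\ge0$ one sets $\alpha=0$. Put $F_Y^{\alpha}(x)=f(x)+\sum_{i=1}^n\alpha_i(a_i^Y-x_i)(b_i^Y-x_i)$ for $x\in Y$, and $w(Y,\alpha)=\sum_{i=1}^n\alpha_i\left(\frac{a_i^Y-b_i^Y}{2}\right)^2$.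 $\mathrm{Sp}(Y)$ is the pair of boxes obtained by halving $Y$ at the midpoint of its longest edge (smallest coordinate index in case of ties). Piecewise convexification algorithm. Input: $X^0=[a,b]$, $f$, $\varepsilon>0$. 1. Compute $\alpha^0$ for $X^0$ by $( * )$. Set $X^*=X^0$, $x^*=\frac{a+b}{2}$, $\mu^*=-\infty$, $\alpha^*=\alpha^0$, $x_{act}=x^*$, $v_{glob}=v_{act}=+\infty$. Set the lists $L_{NC}=\{(X^*,x^*,\mu^*,\alpha^* )\}$, $M_C=M_D=\emptyset$. For each box $\widehat X$ the set $\mathcal{X}_{ap}^{\widehat X}$ of recorded points is initially empty. 2. While $L_{NC}\ne\emptyset$ and $\max_{(\widetilde X,\widetilde x,\widetilde\mu,\widetilde\alpha)\in L_{NC}}w(\widetilde X,\widetilde\alpha)>\varepsilon$: let $(X^*,x^*,\mu^*,\alpha^* )$ be the first element of $L_{NC}$ attaining this maximum and delete it from $L_{NC}$. For each $\widehat X\in\mathrm{Sp}(X^* )$: (i) Compute $\tilde\lambda_{\widehat X}$ and the parameter vector $\widehat\alpha$ of $\widehat X$; choose $\widehat x\in\arg\min_{x\in\widehat X}F_{\widehat X}^{\widehat\alpha}(x)$ and set $\widehat\mu=\min_{x\in\widehat X}F_{\widehat X}^{\widehat\alpha}(x)$. (ii) If $\widehat\mu>v_{glob}$, append $(\widehat X,\widehat x,\widehat\mu,\widehat\alpha)$ to $M_D$. (iii) If $\widehat\mu\le v_{glob}$: append $(\widehat X,\widehat x,\widehat\mu,\widehat\alpha)$ to $M_C$ if $\tilde\lambda_{\widehat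 X}\ge0$, and to $L_{NC}$ otherwise; in both cases add $\widehat x$ to $\mathcal{X}_{ap}^{\widehat X}$. Then, if $f(\widehat x)\le v_{act}$, set $x_{act}=\widehat x$, $v_{act}=f(x_{act})$, $v_{glob}=\min\{v_{act},v_{glob}\}$, and move every $(X,x,\mu,\alpha)\in L_{NC}$ with $\mu>v_{glob}$ from $L_{NC}$ to $M_D$. 3. Let $M$ be the collection of all boxes $\widetilde X$ occurring as first component of an element of $L_{NC}$ or of $M_C$. Output $$\mathcal{X}_{ap}^{new}=\left\{x\in\bigcup_{\widehat X\in M}\mathcal{X}_{ap}^{\widehat X}:\ f(x)\le f(y)\ \ \forall y\in\bigcup_{\widehat X\in M}\mathcal{X}_{ap}^{\widehat X}\right\}.$$ *)

theory Defs
  imports "HOL-Analysis.Analysis"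
begin

definition gradient :: "(real ^ 'n \<Rightarrow> real) \<Rightarrow> real ^ 'n \<Rightarrow> real ^ 'n" where
  "gradient f x = (\<chi> i. frechet_derivative f (at x) (axis i 1))"

definition hessian :: "(real ^ 'n \<Rightarrow> real) \<Rightarrow> real ^ 'n \<Rightarrow> real ^ 'n ^ 'n" where
  "hessian f x = matrix (frechet_derivative (gradient f) (at x))"

definition twice_continuously_differentiable :: "(real ^ 'n \<Rightarrow> real) \<Rightarrow> bool" where
  "twice_continuously_differentiable f \<longleftrightarrow>
     f differentiable_on UNIV \<and> gradient f differentiable_on UNIV \<and>
     continuous_on UNIV (hessian f)"

text \<open>
  The least and greatest values are meant only where they exist, here for
  continuous functions on compact boxes.
\<close>

definition min_over :: "'a set \<Rightarrow> ('a \<Rightarrow> real) \<Rightarrow> real" where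
  "min_over S g = (LEAST m. m \<in> g ` S)"

definition max_over :: "'a set \<Rightarrow> ('a \<Rightarrow> real) \<Rightarrow> real" where
  "max_over S g = (GREATEST m. m \<in> g ` S)"

text \<open>
  A box is represented by its pair of corners. For nondegenerate boxes, the only ones
  that occur, the corners are determined by the set of points.
\<close>

type_synonym 'n corners = "(real ^ 'n) \<times> (real ^ 'n)"

definition pts :: "'n corners \<Rightarrow> (real ^ 'n) set" where
  "pts Y = cbox (fst Y) (snd Y)"

definition hess_row_bound ::
    "(real ^ 'n \<Rightarrow> real) \<Rightarrow> 'n corners \<Rightarrow> 'n \<Rightarrow> real ^ 'n \<Rightarrow> real" where
  "hess_row_bound f Y i d =
     (\<Sum>j\<in>UNIV - {i}.
        max \<bar>min_over (pts Y) (\<lambda>x. hessian f x $ i $ j)\<bar>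
            \<bar>max_over (pts Y) (\<lambda>x. hessian f x $ i $ j)\<bar> * (d $ j / d $ i))"

definition lambda_tilde :: "(real ^ 'n \<Rightarrow> real) \<Rightarrow> 'n corners \<Rightarrow> real" where
  "lambda_tilde f Y =
     Min (range (\<lambda>i. min_over (pts Y) (\<lambda>x. hessian f x $ i $ i) - hess_row_bound f Y i 1))"

definition alpha_formula :: "(real ^ 'n \<Rightarrow> real) \<Rightarrow> 'n corners \<Rightarrow> real ^ 'n" where
  "alpha_formula f Y =
     (\<chi> i. max 0 (- (1 / 2) * (min_over (pts Y) (\<lambda>x. hessian f x $ i $ i)
                                - hess_row_bound f Y i (snd Y - fst Y))))"

definition alpha_sub :: "(real ^ 'n \<Rightarrow> real) \<Rightarrow> 'n corners \<Rightarrow> real ^ 'n" where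
  "alpha_sub f Y = (if lambda_tilde f Y \<ge> 0 then 0 else alpha_formula f Y)"

definition underestimator ::
    "(real ^ 'n \<Rightarrow> real) \<Rightarrow> 'n corners \<Rightarrow> real ^ 'n \<Rightarrow> real ^ 'n \<Rightarrow> real" where
  "underestimator f Y \<alpha> x =
     f x + (\<Sum>i\<in>UNIV. \<alpha> $ i * (fst Y $ i - x $ i) * (snd Y $ i - x $ i))"

definition width :: "'n corners \<Rightarrow> real ^ 'n \<Rightarrow> real" where
  "width Y \<alpha> = (\<Sum>i\<in>UNIV. \<alpha> $ i * ((fst Y $ i - snd Y $ i) / 2)\<^sup>2)"

definition longest_edge :: "('n::{finite,linorder}) corners \<Rightarrow> 'n" where
  "longest_edge Y =
     Min {i. \<forall>j. snd Y $ j - fst Y $ j \<le> snd Y $ i - fst Y $ i}"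

definition halves :: "('n::{finite,linorder}) corners \<Rightarrow> 'n corners set" where
  "halves Y =
     (let k = longest_edge Y; m = (fst Y $ k + snd Y $ k) / 2
      in {(fst Y, \<chi> i. if i = k then m else snd Y $ i),
          (\<chi> i. if i = k then m else fst Y $ i, snd Y)})"

type_synonym 'n entry = "'n corners \<times> (real ^ 'n) \<times> ereal \<times> (real ^ 'n)"

definition entry_width :: "('n::finite) entry \<Rightarrow> real" where
  "entry_width = (\<lambda>(Y, x, \<mu>, \<alpha>). width Y \<alpha>)"

definition entry_mu :: "('n::finite) entry \<Rightarrow> ereal" where
  "entry_mu = (\<lambda>(Y, x, \<mu>, \<alpha>). \<mu>)"

record ('n::finite) pc_state =
  LNC :: "'n entry list"
  MC :: "'n entry list"
  MD :: "'n entry list"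
  Xap :: "'n corners \<Rightarrow> (real ^ 'n) set"
  xact :: "real ^ 'n"
  vact :: ereal
  vglob :: ereal

definition init_state ::
    "(real ^ 'n \<Rightarrow> real) \<Rightarrow> real ^ 'n \<Rightarrow> real ^ 'n \<Rightarrow> ('n::finite) pc_state" where
  "init_state f a b =
     \<lparr> LNC = [((a, b), midpoint a b, -\<infinity>, alpha_formula f (a, b))],
       MC = [], MD = [], Xap = (\<lambda>_. {}),
       xact = midpoint a b, vact = \<infinity>, vglob = \<infinity> \<rparr>"

definition update_act ::
    "(real ^ 'n \<Rightarrow> real) \<Rightarrow> real ^ 'n \<Rightarrow> ('n::finite) pc_state \<Rightarrow> 'n pc_state" where
  "update_act f x s =
     (if ereal (f x) \<le> vact s then
        let v = min (ereal (f x)) (vglob s)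
        in s\<lparr> xact := x, vact := ereal (f x), vglob := v,
              LNC := filter (\<lambda>e. \<not> entry_mu e > v) (LNC s),
              MD := MD s @ filter (\<lambda>e. entry_mu e > v) (LNC s) \<rparr>
      else s)"

definition process_box ::
    "(real ^ 'n \<Rightarrow> real) \<Rightarrow> 'n corners \<Rightarrow> real ^ 'n \<Rightarrow> ('n::finite) pc_state \<Rightarrow> 'n pc_state" where
  "process_box f Y x s =
     (let \<alpha> = alpha_sub f Y;
          \<mu> = ereal (min_over (pts Y) (underestimator f Y \<alpha>));
          e = (Y, x, \<mu>, \<alpha>)
      in if \<mu> > vglob s then s\<lparr> MD := MD s @ [e] \<rparr>
         else update_act f x
           ((if lambda_tilde f Y \<ge> 0 then s\<lparr> MC := MC s @ [e] \<rparr> else s\<lparr> LNC := LNC s @ [e] \<rparr>)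
              \<lparr> Xap := (Xap s)(Y := insert x (Xap s Y)) \<rparr>))"

text \<open>The minimizer on each sub-box is an arbitrary one, so this is a relation.\<close>

inductive process_boxes ::
    "(real ^ ('n::finite) \<Rightarrow> real) \<Rightarrow> 'n corners list \<Rightarrow> 'n pc_state \<Rightarrow> 'n pc_state \<Rightarrow> bool"
  for f where
  Nil: "process_boxes f [] s s"
| Cons: "\<lbrakk> is_arg_min (underestimator f Y (alpha_sub f Y)) (\<lambda>x. x \<in> pts Y) x;
           process_boxes f Ys (process_box f Y x s) s' \<rbrakk>
         \<Longrightarrow> process_boxes f (Y # Ys) s s'"

definition loop_guard :: "real \<Rightarrow> ('n::finite) pc_state \<Rightarrow> bool" where
  "loop_guard \<epsilon> s \<longleftrightarrow> LNC s \<noteq> [] \<and> Max (entry_width ` set (LNC s)) > \<epsilon>"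

text \<open>
  One pass through the loop: \<open>e\<close> is the first list element of maximal width.
  The two halves may be processed in either order.
\<close>

inductive loop_step ::
    "(real ^ ('n::{finite,linorder}) \<Rightarrow> real) \<Rightarrow> real \<Rightarrow> 'n pc_state \<Rightarrow> 'n pc_state \<Rightarrow> bool"
  for f \<epsilon> where
  "\<lbrakk> loop_guard \<epsilon> s;
     LNC s = es @ e # es';
     entry_width e = Max (entry_width ` set (LNC s));
     \<forall>e'\<in>set es. entry_width e' \<noteq> Max (entry_width ` set (LNC s));
     distinct Ys; set Ys = halves (fst e);
     process_boxes f Ys (s\<lparr> LNC := es @ es' \<rparr>) s' \<rbrakk>
   \<Longrightarrow> loop_step f \<epsilon> s s'"

definition final_state ::
    "(real ^ ('n::{finite,linorder}) \<Rightarrow> real) \<Rightarrow> real ^ ('n::{finite,linorder}) \<Rightarrow>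
     real ^ ('n::{finite,linorder}) \<Rightarrow> real \<Rightarrow> 'n pc_state \<Rightarrow> bool" where
  "final_state f a b \<epsilon> s \<longleftrightarrow>
     (loop_step f \<epsilon>)\<^sup>*\<^sup>* (init_state f a b) s \<and> \<not> loop_guard \<epsilon> s"

definition recorded :: "('n::finite) pc_state \<Rightarrow> (real ^ 'n) set" where
  "recorded s = (\<Union>Y\<in>fst ` (set (LNC s) \<union> set (MC s)). Xap s Y)"

definition pc_output :: "(real ^ 'n \<Rightarrow> real) \<Rightarrow> ('n::finite) pc_state \<Rightarrow> (real ^ 'n) set" where
  "pc_output f s = {x \<in> recorded s. \<forall>y\<in>recorded s. f x \<le> f y}"

definition approx_opt_set :: "('a \<Rightarrow> real) \<Rightarrow> 'a set \<Rightarrow> real \<Rightarrow> 'a set" where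
  "approx_opt_set f X \<epsilon> = {x \<in> X. \<forall>y\<in>X. f x \<le> f y + \<epsilon>}"

end

theory Submission
  imports Defs
begin

text \<open>
  Since \<open>\<alpha> \<ge> 0\<close>, the underestimator satisfies \<open>f - w \<le> F \<le> f\<close> on its box. Let \<open>y\<close> minimize \<open>f\<close>
  over the whole box. A sub-box containing \<open>y\<close> has \<open>\<mu> \<le> F y \<le> f y \<le> v\<^sub>g\<^sub>l\<^sub>o\<^sub>b\<close>, so it is never
  discarded, and at every stage \<open>y\<close> lies in a box of \<open>L\<^sub>N\<^sub>C\<close> or \<open>M\<^sub>C\<close>. At termination that box has
  \<open>w \<le> \<epsilon>\<close> (boxes of \<open>M\<^sub>C\<close> have \<open>\<alpha> = 0\<close>), and its recorded minimizer \<open>x\<close> of \<open>F\<close> satisfies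
  \<open>f x \<le> F x + w \<le> F y + \<epsilon> \<le> f y + \<epsilon>\<close>.
\<close>

section \<open>Two-sided bounds for the underestimator on a single box, and bisection\<close>

lemma alpha_sub_nonneg: "0 \<le> alpha_sub f Y $ i"
  by (simp add: alpha_sub_def alpha_formula_def)

lemma underestimator_le:
  assumes "x \<in> pts Y" "\<And>i. 0 \<le> \<alpha> $ i"
  shows "underestimator f Y \<alpha> x \<le> f x"
proof -
  have "\<alpha> $ i * (fst Y $ i - x $ i) * (snd Y $ i - x $ i) \<le> 0" for i
    using assms by (intro mult_nonpos_nonneg mult_nonneg_nonpos)
      (auto simp: pts_def mem_box_cart)
  then show ?thesis
    by (simp add: underestimator_def sum_nonpos)
qed

text \<open>Completing the square: each summand of the perturbation plus the matching summand of
  \<open>width\<close> equals \<open>\<alpha> $ i\<close> times the squared distance of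
  \<open>x $ i\<close> from the midpoint of the edge. So \<open>width\<close> is the depth of the
  perturbation at the centre of the box.\<close>

lemma le_underestimator_plus_width:
  assumes "\<And>i. 0 \<le> \<alpha> $ i"
  shows "f x \<le> underestimator f Y \<alpha> x + width Y \<alpha>"
proof -
  have "0 \<le> \<alpha> $ i * (fst Y $ i - x $ i) * (snd Y $ i - x $ i)
      + \<alpha> $ i * ((fst Y $ i - snd Y $ i) / 2)\<^sup>2" for i
  proof -
    have "\<alpha> $ i * (fst Y $ i - x $ i) * (snd Y $ i - x $ i)
        + \<alpha> $ i * ((fst Y $ i - snd Y $ i) / 2)\<^sup>2
      = \<alpha> $ i * (x $ i - (fst Y $ i + snd Y $ i) / 2)\<^sup>2"
      by (simp add: power2_eq_square field_simps)
    then show ?thesis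
      using assms by simp
  qed
  then show ?thesis
    by (simp add: underestimator_def width_def add.assoc sum_nonneg flip: sum.distrib)
qed

lemma min_over_is_arg_min:
  assumes "is_arg_min g (\<lambda>x. x \<in> S) x"
  shows "min_over S g = g x"
  unfolding min_over_def
  using assms by (intro Least_equality) (auto simp: is_arg_min_linorder)

lemma UN_pts_halves: "(\<Union>Z\<in>halves Y. pts Z) = pts Y"
proof -
  let ?k = "longest_edge Y"
  let ?m = "(fst Y $ ?k + snd Y $ ?k) / 2"
  have "x \<in> pts Y" if "x \<in> pts (fst Y, \<chi> i. if i = ?k then ?m else snd Y $ i)" for x
  proof -
    have *: "fst Y $ i \<le> x $ i" "x $ i \<le> (if i = ?k then ?m else snd Y $ i)" for i
      using that by (auto simp: pts_def mem_box_cart)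
    \<comment> \<open>At the split coordinate, \<open>fst Y $ i \<le> x $ i \<le> ?m\<close> forces
      \<open>fst Y $ i \<le> snd Y $ i\<close>, hence \<open>?m \<le> snd Y $ i\<close>. The other
      half is symmetric.\<close>
    have "x $ i \<le> snd Y $ i" for i
      using *[of i] by (cases "i = ?k") auto
    with * show ?thesis
      by (simp add: pts_def mem_box_cart)
  qed
  moreover have "x \<in> pts Y" if "x \<in> pts (\<chi> i. if i = ?k then ?m else fst Y $ i, snd Y)" for x
  proof -
    have *: "(if i = ?k then ?m else fst Y $ i) \<le> x $ i" "x $ i \<le> snd Y $ i" for i
      using that by (auto simp: pts_def mem_box_cart)
    have "fst Y $ i \<le> x $ i" for i
      using *[of i] by (cases "i = ?k") auto
    with * show ?thesis
      by (simp add: pts_def mem_box_cart)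
  qed
  moreover have "x \<in> pts (fst Y, \<chi> i. if i = ?k then ?m else snd Y $ i) \<or>
      x \<in> pts (\<chi> i. if i = ?k then ?m else fst Y $ i, snd Y)" if "x \<in> pts Y" for x
    using that by (cases "x $ ?k \<le> ?m") (auto simp: pts_def mem_box_cart)
  ultimately show ?thesis
    unfolding halves_def Let_def by auto
qed

text \<open>Here \<open>\<mu>\<close> is tied to the chosen minimizer \<open>x\<close>, and
  \<open>x \<in> Xap s Y\<close> is what later makes \<open>x\<close> a competitor in the
  output.\<close>

definition sound_entry ::
    "(real ^ 'n \<Rightarrow> real) \<Rightarrow> (real ^ 'n) set \<Rightarrow> ('n::finite) pc_state \<Rightarrow> 'n entry \<Rightarrow> bool" where
  "sound_entry f X s = (\<lambda>(Y, x, \<mu>, \<alpha>). pts Y \<subseteq> X \<and> \<alpha> = alpha_sub f Y \<and>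
     is_arg_min (underestimator f Y \<alpha>) (\<lambda>x. x \<in> pts Y) x \<and>
     \<mu> = ereal (underestimator f Y \<alpha> x) \<and> x \<in> Xap s Y)"

text \<open>
  The loop invariant, stated for a minimizer \<open>y\<close> of \<open>f\<close> over \<open>X\<close>; the set \<open>P\<close> is the part of
  \<open>X\<close> covered by the halves that are still to be processed in the current pass.
\<close>

definition sound_state ::
    "(real ^ 'n \<Rightarrow> real) \<Rightarrow> (real ^ 'n) set \<Rightarrow> real ^ 'n \<Rightarrow> (real ^ 'n) set \<Rightarrow>
     ('n::finite) pc_state \<Rightarrow> bool" where
  "sound_state f X y P s \<longleftrightarrow>
     ereal (f y) \<le> vglob s \<and>
     (\<forall>e\<in>set (LNC s) \<union> set (MC s). sound_entry f X s e) \<and>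
     (\<forall>e\<in>set (MC s). lambda_tilde f (fst e) \<ge> 0) \<and>
     (\<forall>Y. Xap s Y \<subseteq> pts Y) \<and>
     y \<in> P \<union> (\<Union>e\<in>set (LNC s) \<union> set (MC s). pts (fst e))"

section \<open>Preservation of the invariant by the steps of the algorithm\<close>

lemma sound_stateD:
  assumes "sound_state f X y P s"
  shows "ereal (f y) \<le> vglob s"
    and "e \<in> set (LNC s) \<union> set (MC s) \<Longrightarrow> sound_entry f X s e"
    and "e \<in> set (MC s) \<Longrightarrow> lambda_tilde f (fst e) \<ge> 0"
    and "Xap s Y \<subseteq> pts Y"
    and "y \<in> P \<union> (\<Union>e\<in>set (LNC s) \<union> set (MC s). pts (fst e))"
  using assms unfolding sound_state_def by blast+

lemma sound_entry_mono:
  assumes "sound_entry f X s e" "\<And>Y. Xap s Y \<subseteq> Xap t Y"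
  shows "sound_entry f X t e"
proof -
  obtain Y x \<mu> \<alpha> where e: "e = (Y, x, \<mu>, \<alpha>)"
    by (cases e)
  show ?thesis
    using assms(1) assms(2)[of Y] unfolding e sound_entry_def by blast
qed

text \<open>The minimum of the underestimator on the box is at most its value at \<open>y\<close>,
  which is at most \<open>f y\<close>. As \<open>vglob\<close> never drops below the global minimum,
  no discarding test can remove a box containing a global minimizer.\<close>

lemma sound_entry_mu_le:
  assumes "sound_entry f X s e" "y \<in> pts (fst e)"
  shows "entry_mu e \<le> ereal (f y)"
proof -
  obtain Y x \<mu> \<alpha> where e: "e = (Y, x, \<mu>, \<alpha>)"
    by (cases e)
  have "underestimator f Y \<alpha> x \<le> underestimator f Y \<alpha> y"
    using assms by (auto simp: e sound_entry_def is_arg_min_linorder)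
  also have "\<dots> \<le> f y"
    using assms by (intro underestimator_le) (auto simp: e sound_entry_def alpha_sub_nonneg)
  finally show ?thesis
    using assms by (simp add: e sound_entry_def entry_mu_def)
qed

text \<open>The new \<open>vglob\<close> is the smaller of \<open>f x\<close> and the old one, both
  at least \<open>f y\<close>. Entries purged from \<open>LNC\<close> therefore have
  \<open>\<mu>\<close> above \<open>f y\<close>, so their boxes miss \<open>y\<close>.\<close>

lemma sound_state_update_act:
  assumes s: "sound_state f X y P s" and le: "f y \<le> f x"
  shows "sound_state f X y P (update_act f x s)"
proof (cases "ereal (f x) \<le> vact s")
  case True
  define v where "v = min (ereal (f x)) (vglob s)"
  define t where "t = update_act f x s"
  have t: "vglob t = v" "set (LNC t) = {e \<in> set (LNC s). \<not> entry_mu e > v}"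
    "MC t = MC s" "Xap t = Xap s"
    using True by (simp_all add: t_def update_act_def v_def Let_def)
  have v: "ereal (f y) \<le> v"
    using sound_stateD(1)[OF s] le by (simp add: v_def)
  have keep: "e \<in> set (LNC t)" if "e \<in> set (LNC s)" "y \<in> pts (fst e)" for e
  proof -
    have "entry_mu e \<le> ereal (f y)"
      using sound_entry_mu_le[OF sound_stateD(2)[OF s]] that by blast
    with v that show ?thesis
      by (simp add: t order_trans leD)
  qed
  have "sound_entry f X t e" if "e \<in> set (LNC t) \<union> set (MC t)" for e
  proof (rule sound_entry_mono)
    show "sound_entry f X s e"
      using that by (intro sound_stateD(2)[OF s]) (auto simp: t)
  qed (simp add: t)
  moreover have "y \<in> P \<union> (\<Union>e\<in>set (LNC t) \<union> set (MC t). pts (fst e))"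
  proof (cases "y \<in> P")
    case False
    then obtain e where "e \<in> set (LNC s) \<union> set (MC s)" "y \<in> pts (fst e)"
      using sound_stateD(5)[OF s] by blast
    with keep[of e] have "e \<in> set (LNC t) \<union> set (MC t)"
      by (auto simp: t(3))
    with \<open>y \<in> pts (fst e)\<close> show ?thesis
      by blast
  qed simp
  ultimately have "sound_state f X y P t"
    using sound_stateD(3,4)[OF s] v by (simp add: sound_state_def t(1,3,4))
  then show ?thesis
    by (simp add: t_def)
next
  case False
  with s show ?thesis
    by (simp add: update_act_def)
qed

text \<open>\<open>Y\<close> leaves the pending region: either it is discarded, and then
  \<open>y\<close> is not in it, or its entry joins one of the lists before
  \<open>update_act\<close> runs and covers \<open>pts Y\<close> there.\<close>

lemma sound_state_process_box:
  assumes s: "sound_state f X y (pts Y \<union> P) s"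
    and x: "is_arg_min (underestimator f Y (alpha_sub f Y)) (\<lambda>x. x \<in> pts Y) x"
    and Y: "pts Y \<subseteq> X" and y: "\<forall>z\<in>X. f y \<le> f z"
  shows "sound_state f X y P (process_box f Y x s)"
proof -
  let ?\<mu> = "ereal (underestimator f Y (alpha_sub f Y) x)"
  let ?e = "(Y, x, ?\<mu>, alpha_sub f Y)"
  have xY: "x \<in> pts Y"
    using x by (simp add: is_arg_min_def)
  show ?thesis
  proof (cases "?\<mu> > vglob s")
    case True
    have "y \<notin> pts Y"
    proof
      assume "y \<in> pts Y"
      \<comment> \<open>The point of a discarded box is not recorded, so its entry need not be sound
        in \<open>s\<close>. An artificial state with every point recorded makes it sound, and the
        resulting bound on \<open>\<mu>\<close> does not mention the state.\<close>
      moreover have "sound_entry f X (s\<lparr> Xap := \<lambda>_. UNIV \<rparr>) ?e"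
        using x Y by (simp add: sound_entry_def)
      ultimately have "?\<mu> \<le> ereal (f y)"
        using sound_entry_mu_le by (fastforce simp: entry_mu_def)
      also have "\<dots> \<le> vglob s"
        using s by (simp add: sound_state_def)
      finally show False
        using True by simp
    qed
    then have "sound_state f X y P (s\<lparr> MD := MD s @ [?e] \<rparr>)"
      using s by (simp add: sound_state_def sound_entry_def)
    moreover have "process_box f Y x s = s\<lparr> MD := MD s @ [?e] \<rparr>"
      using True x by (simp add: process_box_def min_over_is_arg_min Let_def)
    ultimately show ?thesis
      by simp
  next
    case False
    define t where "t = (if lambda_tilde f Y \<ge> 0 then s\<lparr> MC := MC s @ [?e] \<rparr>
      else s\<lparr> LNC := LNC s @ [?e] \<rparr>) \<lparr> Xap := (Xap s)(Y := insert x (Xap s Y)) \<rparr>"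
    have "process_box f Y x s = update_act f x t"
      using False x by (simp add: process_box_def min_over_is_arg_min t_def Let_def)
    moreover have "sound_state f X y P t"
    proof -
      have t: "vglob t = vglob s" "Xap t = (Xap s)(Y := insert x (Xap s Y))"
        "set (LNC t) \<union> set (MC t) = insert ?e (set (LNC s) \<union> set (MC s))"
        "set (MC t) \<subseteq> set (MC s) \<union> (if lambda_tilde f Y \<ge> 0 then {?e} else {})"
        by (auto simp: t_def)
      have "sound_entry f X t e" if "e \<in> set (LNC t) \<union> set (MC t)" for e
      proof (cases "e = ?e")
        case True
        then show ?thesis
          using x Y by (simp add: sound_entry_def t(2))
      next
        case False
        then have "sound_entry f X s e"
          using that unfolding t(3) by (intro sound_stateD(2)[OF s]) blast
        then show ?thesis
          by (rule sound_entry_mono) (auto simp: t(2))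
      qed
      moreover have "lambda_tilde f (fst e) \<ge> 0" if "e \<in> set (MC t)" for e
        using sound_stateD(3)[OF s, of e] that t(4) by (auto split: if_splits)
      moreover have "Xap t Z \<subseteq> pts Z" for Z
        using sound_stateD(4)[OF s, of Z] xY by (auto simp: t(2))
      moreover have "y \<in> P \<union> (\<Union>e\<in>set (LNC t) \<union> set (MC t). pts (fst e))"
        using sound_stateD(5)[OF s] unfolding t(3) by (simp add: disj_ac)
      ultimately show ?thesis
        using sound_stateD(1)[OF s] unfolding sound_state_def t(1) by blast
    qed
    moreover have "f y \<le> f x"
      using xY Y y by auto
    ultimately show ?thesis
      using sound_state_update_act by metis
  qed
qed

lemma sound_state_process_boxes:
  assumes "process_boxes f Ys s s'" "sound_state f X y (\<Union>Y\<in>set Ys. pts Y) s"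
    and "(\<Union>Y\<in>set Ys. pts Y) \<subseteq> X" "\<forall>z\<in>X. f y \<le> f z"
  shows "sound_state f X y {} s'"
  using assms
proof (induction rule: process_boxes.induct)
  case (Nil s)
  then show ?case
    by simp
next
  case (Cons Y x Ys s s')
  then show ?case
    using sound_state_process_box[of f X y Y "\<Union>Y\<in>set Ys. pts Y" s x] by simp
qed

text \<open>The initial entry is not sound, since its midpoint is unrecorded, so the initial state
  is a separate case. The first pass removes that entry, leaving empty lists and all of
  \<open>cbox a b\<close> pending. In later passes the box of the removed entry is pending, and its
  halves cover it.\<close>

lemma sound_state_loop_step:
  assumes step: "loop_step f \<epsilon> s s'" and s: "s = init_state f a b \<or> sound_state f (cbox a b) y {} s"
    and y: "y \<in> cbox a b" "\<forall>z\<in>cbox a b. f y \<le> f z"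
  shows "sound_state f (cbox a b) y {} s'"
  using step
proof cases
  case (1 es e es' Ys)
  have Ys: "(\<Union>Y\<in>set Ys. pts Y) = pts (fst e)"
    using 1 UN_pts_halves by metis
  have "sound_state f (cbox a b) y (pts (fst e)) (s\<lparr> LNC := es @ es' \<rparr>) \<and> pts (fst e) \<subseteq> cbox a b"
    using s
  proof
    assume init: "s = init_state f a b"
    then have "es = []" "es' = []" "fst e = (a, b)"
      using 1 by (auto simp: init_state_def append_eq_Cons_conv Cons_eq_append_conv)
    then show ?thesis
      using y by (simp add: init sound_state_def init_state_def pts_def)
  next
    assume s: "sound_state f (cbox a b) y {} s"
    let ?t = "s\<lparr> LNC := es @ es' \<rparr>"
    have LNC: "set (LNC s) = insert e (set (LNC ?t))"
      using 1(2) by simp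
    have "sound_entry f (cbox a b) s e"
      using sound_stateD(2)[OF s] LNC by blast
    then have "pts (fst e) \<subseteq> cbox a b"
      by (auto simp: sound_entry_def)
    moreover have "sound_entry f (cbox a b) ?t e'" if "e' \<in> set (LNC ?t) \<union> set (MC ?t)" for e'
    proof (rule sound_entry_mono)
      show "sound_entry f (cbox a b) s e'"
        using that LNC by (intro sound_stateD(2)[OF s]) simp
    qed simp
    moreover have "y \<in> pts (fst e) \<union> (\<Union>e\<in>set (LNC ?t) \<union> set (MC ?t). pts (fst e))"
      using sound_stateD(5)[OF s] unfolding LNC by simp
    ultimately show ?thesis
      using sound_stateD(1,3,4)[OF s] by (simp add: sound_state_def)
  qed
  then show ?thesis
    using sound_state_process_boxes[OF 1(7)] y(2) by (simp add: Ys)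
qed

lemma sound_state_reachable:
  assumes "(loop_step f \<epsilon>)\<^sup>*\<^sup>* (init_state f a b) s"
    and "y \<in> cbox a b" "\<forall>z\<in>cbox a b. f y \<le> f z"
  shows "s = init_state f a b \<or> sound_state f (cbox a b) y {} s"
  using assms(1)
  by (induction rule: rtranclp_induct) (use sound_state_loop_step assms(2,3) in blast)+

section \<open>Final states and their output\<close>

lemma entry_width_le_final:
  assumes s: "sound_state f X y {} s" "\<not> loop_guard \<epsilon> s" and "0 \<le> \<epsilon>"
    and e: "e \<in> set (LNC s) \<union> set (MC s)"
  shows "entry_width e \<le> \<epsilon>"
proof (cases "e \<in> set (LNC s)")
  case True
  then have "entry_width e \<le> Max (entry_width ` set (LNC s))"
    by simp
  also have "\<dots> \<le> \<epsilon>"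
    using s(2) True by (auto simp: loop_guard_def)
  finally show ?thesis .
next
  case False
  then have "lambda_tilde f (fst e) \<ge> 0" "sound_entry f X s e"
    using sound_stateD(2,3)[OF s(1)] e by blast+
  then show ?thesis
    using \<open>0 \<le> \<epsilon>\<close> by (auto simp: entry_width_def sound_entry_def alpha_sub_def width_def)
qed

lemma sound_state_output:
  assumes s: "sound_state f X y {} s" "\<not> loop_guard \<epsilon> s" and "0 \<le> \<epsilon>"
    and y: "\<forall>z\<in>X. f y \<le> f z"
  shows "pc_output f s \<subseteq> approx_opt_set f X \<epsilon>"
proof
  fix x assume x: "x \<in> pc_output f s"
  obtain e where e: "e \<in> set (LNC s) \<union> set (MC s)" "y \<in> pts (fst e)"
    using sound_stateD(5)[OF s(1)] by blast
  obtain Y p \<mu> \<alpha> where e_eq: "e = (Y, p, \<mu>, \<alpha>)"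
    by (cases e)
  have sound: "sound_entry f X s e"
    by (rule sound_stateD(2)[OF s(1) e(1)])
  then have \<alpha>: "0 \<le> \<alpha> $ i" for i
    by (simp add: e_eq sound_entry_def alpha_sub_nonneg)
  \<comment> \<open>Soundness records \<open>p\<close> for its own box \<open>Y\<close>, which still
    occurs in a final list, so the output point \<open>x\<close> has been compared with
    \<open>p\<close>.\<close>
  have "p \<in> recorded s"
    using sound e(1) unfolding recorded_def e_eq sound_entry_def by force
  then have "f x \<le> f p"
    using x by (simp add: pc_output_def)
  also have "\<dots> \<le> underestimator f Y \<alpha> p + width Y \<alpha>"
    by (rule le_underestimator_plus_width) (rule \<alpha>)
  also have "underestimator f Y \<alpha> p \<le> f y"
    using sound_entry_mu_le[OF sound e(2)] sound
    by (simp add: e_eq entry_mu_def sound_entry_def)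
  also have "width Y \<alpha> \<le> \<epsilon>"
    using entry_width_le_final[OF s \<open>0 \<le> \<epsilon>\<close> e(1)] by (simp add: e_eq entry_width_def)
  finally have "f x \<le> f y + \<epsilon>"
    by simp
  then have "\<forall>z\<in>X. f x \<le> f z + \<epsilon>"
    using y by force
  \<comment> \<open>Points recorded for a box lie in it, and boxes of sound entries lie in
    \<open>X\<close>.\<close>
  moreover have "x \<in> X"
  proof -
    obtain e' where e': "e' \<in> set (LNC s) \<union> set (MC s)" "x \<in> Xap s (fst e')"
      using x unfolding pc_output_def recorded_def by blast
    then have "sound_entry f X s e'" "x \<in> pts (fst e')"
      using sound_stateD(2,4)[OF s(1)] by blast+
    then show ?thesis
      by (auto simp: sound_entry_def)
  qed
  ultimately show "x \<in> approx_opt_set f X \<epsilon>"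
    by (simp add: approx_opt_set_def)
qed

theorem theorem4p2:
  fixes f :: "real ^ ('n::{finite,linorder}) \<Rightarrow> real"
    and a b :: "real ^ ('n::{finite,linorder})" and \<epsilon> :: real and s :: "'n pc_state"
  assumes "\<forall>i. a $ i < b $ i"
    and "twice_continuously_differentiable f"
    and "\<not> convex_on UNIV f"
    and "\<epsilon> > 0"
    and "final_state f a b \<epsilon> s"
  shows "pc_output f s \<subseteq> approx_opt_set f (cbox a b) \<epsilon>"
proof -
  have "continuous_on (cbox a b) f"
    using assms(2) unfolding twice_continuously_differentiable_def
    by (meson continuous_on_subset differentiable_imp_continuous_on subset_UNIV)
  moreover have "cbox a b \<noteq> {}"
    using assms(1) by (simp add: interval_ne_empty_cart less_imp_le)
  ultimately obtain y where y: "y \<in> cbox a b" "\<forall>z\<in>cbox a b. f y \<le> f z"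
    using continuous_attains_inf[OF compact_cbox] by blast
  have "s = init_state f a b \<or> sound_state f (cbox a b) y {} s"
    using assms(5) y by (intro sound_state_reachable) (auto simp: final_state_def)
  then show ?thesis
  proof
    \<comment> \<open>The guard fails at once: nothing has been recorded and the output is
      empty.\<close>
    assume "s = init_state f a b"
    then show ?thesis
      by (simp add: pc_output_def recorded_def init_state_def)
  next
    assume "sound_state f (cbox a b) y {} s"
    then show ?thesis
      using assms(4,5) y(2) by (intro sound_state_output) (auto simp: final_state_def)
  qed
qed

end
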